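(* Every graph $G$ with $cr(G)\leq 10$ is biplanar.
   Context: $cr(G)$ denotes the minimum number of edge crossings over all drawings of $G$ in the plane (simple drawings: no two edges cross more than once, no three edges cross at a point). A graph $G=(V,E)$ is biplanar if there is a partition $E=E_1\cup E_2$, $E_1\cap E_2=\emptyset$, such that both $G_1=(V,E_1)$ and $G_2=(V,E_2)$ are planar. *)

theory Defs
  imports "HOL-Analysis.Analysis"
begin

definition graph :: "'a set \<Rightarrow> 'a set set \<Rightarrow> bool" where
  "graph V E \<longleftrightarrow> finite V \<and> (\<forall>e\<in>E. \<exists>u v. u \<in> V \<and> v \<in> V \<and> u \<noteq> v \<and> e = {u, v})"

definition drawing ::
  "'a set \<Rightarrow> 'a set set \<Rightarrow> ('a \<Rightarrow> complex) \<Rightarrow> ('a set \<Rightarrow> real \<Rightarrow> complex) \<Rightarrow> bool" where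
  "drawing V E p \<gamma> \<longleftrightarrow> inj_on p V \<and>
     (\<forall>e\<in>E. arc (\<gamma> e) \<and> {pathstart (\<gamma> e), pathfinish (\<gamma> e)} = p ` e \<and>
             path_image (\<gamma> e) \<inter> p ` V = p ` e)"

definition edge_interior :: "('a \<Rightarrow> complex) \<Rightarrow> ('a set \<Rightarrow> real \<Rightarrow> complex) \<Rightarrow> 'a set \<Rightarrow> complex set" where
  "edge_interior p \<gamma> e = path_image (\<gamma> e) - p ` e"

definition simple_drawing ::
  "'a set \<Rightarrow> 'a set set \<Rightarrow> ('a \<Rightarrow> complex) \<Rightarrow> ('a set \<Rightarrow> real \<Rightarrow> complex) \<Rightarrow> bool" where
  "simple_drawing V E p \<gamma> \<longleftrightarrow> drawing V E p \<gamma> \<and>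
     (\<forall>e\<in>E. \<forall>f\<in>E. e \<noteq> f \<longrightarrow>
        (\<forall>x y. x \<in> edge_interior p \<gamma> e \<inter> edge_interior p \<gamma> f \<longrightarrow>
               y \<in> edge_interior p \<gamma> e \<inter> edge_interior p \<gamma> f \<longrightarrow> x = y)) \<and>
     (\<forall>e\<in>E. \<forall>f\<in>E. \<forall>g\<in>E. e \<noteq> f \<and> e \<noteq> g \<and> f \<noteq> g \<longrightarrow>
        edge_interior p \<gamma> e \<inter> edge_interior p \<gamma> f \<inter> edge_interior p \<gamma> g = {})"

text \<open>Number of crossings of a simple drawing (each crossing pair crosses exactly once).\<close>
definition crossings ::
  "'a set set \<Rightarrow> ('a \<Rightarrow> complex) \<Rightarrow> ('a set \<Rightarrow> real \<Rightarrow> complex) \<Rightarrow> nat" where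
  "crossings E p \<gamma> = card {{e, f} | e f. e \<in> E \<and> f \<in> E \<and> e \<noteq> f \<and>
                        edge_interior p \<gamma> e \<inter> edge_interior p \<gamma> f \<noteq> {}}"

definition cr :: "'a set \<Rightarrow> 'a set set \<Rightarrow> nat" where
  "cr V E = (LEAST k. \<exists>p \<gamma>. simple_drawing V E p \<gamma> \<and> crossings E p \<gamma> = k)"

definition planar :: "'a set \<Rightarrow> 'a set set \<Rightarrow> bool" where
  "planar V E \<longleftrightarrow> (\<exists>p \<gamma>. drawing V E p \<gamma> \<and>
     (\<forall>e\<in>E. \<forall>f\<in>E. e \<noteq> f \<longrightarrow> edge_interior p \<gamma> e \<inter> edge_interior p \<gamma> f = {}))"

definition biplanar :: "'a set \<Rightarrow> 'a set set \<Rightarrow> bool" where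
  "biplanar V E \<longleftrightarrow> (\<exists>E1 E2. E = E1 \<union> E2 \<and> E1 \<inter> E2 = {} \<and> planar V E1 \<and> planar V E2)"

end

theory Submission
  imports Defs
begin

text \<open>
  Fix a simple drawing with at most 10 crossings and let H be its conflict graph: the vertices of H
  are the edges of G, joined when they cross. A set of edges that is independent in H inherits a
  crossing-free drawing, so it suffices to find a vertex cover F of H that is a planar graph.
  If H is bipartite, a colour class will do. Otherwise either H has a vertex cover of at most 8
  edges, or H consists of a triangle and disjoint single edges, and then
  there are covers \<open>S \<union> {a}\<close> and \<open>S \<union> {b}\<close>
  with \<open>a \<noteq> b\<close> and \<open>|S| \<le> 8\<close>.

  A graph with at most 9 edges is planar unless it has 9 edges and is cubic on its non-isolated
  vertices: vertices of degree 1 and 2 can be removed (the latter by joining their neighbours), and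
  minimum degree 3 forces at most 5 vertices by double counting, hence a subgraph of K5 minus an
  edge. In the exceptional case \<open>S \<union> {a}\<close> and
  \<open>S \<union> {b}\<close> cannot both be cubic, since this would force \<open>a = b\<close>.
\<close>

subsection \<open>Straight-line drawings\<close>

text \<open>Finitely many lines form a null set in the plane, while a nonempty open set is not null.
  Every general-position choice below is made this way.\<close>

lemma exists_off_lines:
  fixes S :: "complex set"
  assumes "finite L" "open S" "S \<noteq> {}"
  obtains q where "q \<in> S" "\<And>a b. (a, b) \<in> L \<Longrightarrow> a \<noteq> b \<Longrightarrow> \<not> collinear {a, b, q}"
proof -
  define N where "N = (\<Union>(a, b)\<in>L. affine hull {a, b})"
  have "negligible (affine hull {a, b})" for a b :: complex
  proof -
    have "interior (affine hull {a, b}) = {}"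
      by (rule empty_interior_affine_hull) (auto simp: card_insert_if)
    then show ?thesis
      by (simp add: negligible_convex_interior affine_imp_convex)
  qed
  then have "negligible N"
    unfolding N_def using \<open>finite L\<close> by (intro negligible_Union) auto
  then have "\<not> S \<subseteq> N"
    using assms open_not_negligible negligible_subset by blast
  then obtain q where "q \<in> S" "q \<notin> N" by blast
  then show ?thesis
    using that[of q] unfolding N_def by (auto simp: collinear_3_affine_hull)
qed

lemma Int_segments_at_common_end:
  fixes a b c :: complex
  assumes "\<not> collinear {a, b, c}"
  shows "convex hull {a, b} \<inter> convex hull {a, c} = {a}"
  using Int_closed_segment[of a b c] assms
  by (simp add: segment_convex_hull insert_commute)

lemma in_segment_collinear:
  fixes a b x :: complex
  assumes "x \<in> convex hull {a, b}"
  shows "collinear {a, b, x}"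
  using assms affine_hull_3_imp_collinear convex_hull_subset_affine_hull by blast

text \<open>A straight-line drawing is encoded by the simplices of a geometric complex: edges as
  two-element sets, vertices as singletons. Taking the singletons as simplices makes the condition
  cover injectivity and vertices lying on edges.\<close>

definition geometric_complex :: "('a \<Rightarrow> complex) \<Rightarrow> 'a set set \<Rightarrow> bool" where
  "geometric_complex p K \<longleftrightarrow>
     (\<forall>s\<in>K. \<forall>t\<in>K. s \<noteq> t \<longrightarrow> convex hull (p ` s) \<inter> convex hull (p ` t) \<subseteq> p ` (s \<inter> t))"

text \<open>Edges are unordered, so the segment is given an arbitrary direction by choice; only its
  image and its unordered pair of ends matter later.\<close>

definition straight :: "('a \<Rightarrow> complex) \<Rightarrow> 'a set \<Rightarrow> real \<Rightarrow> complex" where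
  "straight p e = (SOME g. \<exists>u v. u \<noteq> v \<and> e = {u, v} \<and> g = linepath (p u) (p v))"

lemma straight_edge:
  assumes "u \<noteq> v"
  shows "path_image (straight p {u, v}) = convex hull (p ` {u, v})"
    and "{pathstart (straight p {u, v}), pathfinish (straight p {u, v})} = p ` {u, v}"
    and "p u \<noteq> p v \<Longrightarrow> arc (straight p {u, v})"
proof -
  have "\<exists>g u' v'. u' \<noteq> v' \<and> {u, v} = {u', v'} \<and> g = linepath (p u') (p v')"
    using assms by blast
  from someI_ex[OF this] obtain u' v'
    where "{u, v} = {u', v'}" "straight p {u, v} = linepath (p u') (p v')"
    unfolding straight_def by blast
  then show "path_image (straight p {u, v}) = convex hull (p ` {u, v})"
    and "{pathstart (straight p {u, v}), pathfinish (straight p {u, v})} = p ` {u, v}"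
    and "p u \<noteq> p v \<Longrightarrow> arc (straight p {u, v})"
    by (auto simp: doubleton_eq_iff segment_convex_hull insert_commute intro!: arc_linepath)
qed

lemma straight_drawing:
  assumes "graph V E" "inj_on p V"
    and "\<And>e v. e \<in> E \<Longrightarrow> v \<in> V \<Longrightarrow> p v \<in> convex hull (p ` e) \<Longrightarrow> v \<in> e"
  shows "drawing V E p (straight p)"
  unfolding drawing_def
proof (intro conjI ballI assms(2))
  fix e assume e: "e \<in> E"
  then obtain u v where uv: "u \<in> V" "v \<in> V" "u \<noteq> v" "e = {u, v}"
    using assms(1) by (auto simp: graph_def)
  then have "p u \<noteq> p v" using assms(2) by (meson inj_on_eq_iff)
  with uv show "arc (straight p e)"
    and "{pathstart (straight p e), pathfinish (straight p e)} = p ` e"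
    using straight_edge[of u v p] by auto
  show "path_image (straight p e) \<inter> p ` V = p ` e"
    using straight_edge(1)[of u v p] uv assms(3)[OF e] hull_subset[of "p ` e" convex] by auto
qed

lemma edge_interior_straight:
  assumes "graph V E" "e \<in> E"
  shows "edge_interior p (straight p) e = convex hull (p ` e) - p ` e"
proof -
  obtain u v where "u \<noteq> v" "e = {u, v}" using assms unfolding graph_def by blast
  then show ?thesis by (simp add: edge_interior_def straight_edge(1))
qed

text \<open>Singleton against singleton gives injectivity, and singleton against edge keeps vertices
  off foreign edges. Two edges meet only in images of common ends, which
  \<open>edge_interior\<close> removes.\<close>

lemma geometric_complex_imp_planar:
  assumes "graph V E" and K: "geometric_complex p (E \<union> (\<lambda>v. {v}) ` V)"
  shows "planar V E"
proof -
  have *: "convex hull (p ` s) \<inter> convex hull (p ` t) \<subseteq> p ` (s \<inter> t)"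
    if "s \<in> E \<union> (\<lambda>v. {v}) ` V" "t \<in> E \<union> (\<lambda>v. {v}) ` V" "s \<noteq> t" for s t
    using K[unfolded geometric_complex_def, rule_format, OF that] .
  have "inj_on p V"
  proof (rule inj_onI, rule ccontr)
    fix u v assume "u \<in> V" "v \<in> V" "p u = p v" "u \<noteq> v"
    with *[of "{u}" "{v}"] show False by auto
  qed
  moreover have "v \<in> e" if "e \<in> E" "v \<in> V" "p v \<in> convex hull (p ` e)" for e v
    using *[of e "{v}"] that by auto
  ultimately have "drawing V E p (straight p)"
    using straight_drawing assms(1) by blast
  moreover have "edge_interior p (straight p) e \<inter> edge_interior p (straight p) f = {}"
    if "e \<in> E" "f \<in> E" "e \<noteq> f" for e f
    using *[of e f] that by (auto simp: edge_interior_straight[OF assms(1)])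
  ultimately show ?thesis
    unfolding planar_def by blast
qed

section \<open>Adding vertices to a straight-line drawing\<close>

lemma geometric_complex_mono:
  "geometric_complex p K \<Longrightarrow> K' \<subseteq> K \<Longrightarrow> geometric_complex p K'"
  unfolding geometric_complex_def by blast

text \<open>The segment from \<open>a\<close> to \<open>m\<close> has positive distance
  \<open>d\<close> from \<open>T\<close>. Moving the end \<open>m\<close> to \<open>q\<close> moves
  the point with parameter \<open>t\<close> by \<open>t * dist q m\<close>, which is at most
  \<open>dist q m\<close>.\<close>

lemma eventually_segment_avoids:
  fixes a m :: complex
  assumes "compact T" "convex hull {a, m} \<inter> T = {}"
  shows "\<forall>\<^sub>F q in nhds m. convex hull {a, q} \<inter> T = {}"
proof -
  have "closed T" using assms(1) compact_imp_closed by blast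
  moreover have "compact (convex hull {a, m})"
    by (simp add: compact_convex_hull)
  ultimately obtain d where d: "d > 0" "\<And>x y. x \<in> convex hull {a, m} \<Longrightarrow> y \<in> T \<Longrightarrow> d \<le> dist x y"
    using separate_compact_closed[of "convex hull {a, m}" T] assms(2) by blast
  have "convex hull {a, q} \<inter> T = {}" if "dist q m < d" for q
  proof (rule ccontr)
    assume "convex hull {a, q} \<inter> T \<noteq> {}"
    then obtain t where t: "0 \<le> t" "t \<le> 1" "(1 - t) *\<^sub>R a + t *\<^sub>R q \<in> T"
      by (auto simp: segment_convex_hull[symmetric] in_segment)
    have "(1 - t) *\<^sub>R a + t *\<^sub>R m \<in> convex hull {a, m}"
      using t by (auto simp: segment_convex_hull[symmetric] in_segment)
    with d t have "d \<le> dist ((1 - t) *\<^sub>R a + t *\<^sub>R m) ((1 - t) *\<^sub>R a + t *\<^sub>R q)" by blast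
    also have "\<dots> = t * dist q m"
      using t by (simp add: dist_norm norm_minus_commute flip: scaleR_diff_right)
    also have "\<dots> \<le> dist q m" using t by (simp add: mult_left_le_one_le)
    finally show False using that by simp
  qed
  then show ?thesis
    unfolding eventually_nhds_metric using d(1) by blast
qed

text \<open>A new vertex placed at \<open>q\<close> may be joined to \<open>u\<close> by a segment, provided \<open>q\<close> is close enough to \<open>m\<close>
  and in general position. Below \<open>m\<close> is \<open>p u\<close> itself (new leaf) or the midpoint of an edge at \<open>u\<close>
  (new vertex of degree 2).\<close>

lemma eventually_new_edge_ok:
  fixes p :: "'a \<Rightarrow> complex"
  assumes "finite K" and small: "\<And>s. s \<in> K \<Longrightarrow> \<exists>x y. s = {x, y}"
    and disj: "\<And>s. s \<in> K \<Longrightarrow> u \<notin> s \<Longrightarrow> convex hull {p u, m} \<inter> convex hull (p ` s) = {}"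
  shows "\<forall>\<^sub>F q in nhds m. (\<forall>b\<in>\<Union>K. p b \<noteq> p u \<longrightarrow> \<not> collinear {p u, p b, q}) \<longrightarrow>
           (\<forall>s\<in>K. convex hull {p u, q} \<inter> convex hull (p ` s) \<subseteq> p ` ({u} \<inter> s))"
proof -
  have "\<forall>\<^sub>F q in nhds m. \<forall>s\<in>{s\<in>K. u \<notin> s}. convex hull {p u, q} \<inter> convex hull (p ` s) = {}"
  proof (rule eventually_ball_finite)
    show "\<forall>s\<in>{s\<in>K. u \<notin> s}. \<forall>\<^sub>F q in nhds m. convex hull {p u, q} \<inter> convex hull (p ` s) = {}"
    proof
      fix s assume s: "s \<in> {s\<in>K. u \<notin> s}"
      then have "finite s" using small by fastforce
      then have "compact (convex hull (p ` s))"
        by (intro compact_convex_hull finite_imp_compact finite_imageI)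
      then show "\<forall>\<^sub>F q in nhds m. convex hull {p u, q} \<inter> convex hull (p ` s) = {}"
        using eventually_segment_avoids disj s by blast
    qed
  qed (use assms in auto)
  then show ?thesis
  proof (eventually_elim, intro impI ballI)
    fix q s
    assume q: "\<forall>s\<in>{s\<in>K. u \<notin> s}. convex hull {p u, q} \<inter> convex hull (p ` s) = {}"
      "\<forall>b\<in>\<Union>K. p b \<noteq> p u \<longrightarrow> \<not> collinear {p u, p b, q}" and s: "s \<in> K"
    show "convex hull {p u, q} \<inter> convex hull (p ` s) \<subseteq> p ` ({u} \<inter> s)"
    \<comment> \<open>Simplices without \<open>u\<close> are avoided by closeness to
      \<open>m\<close>. A simplex through \<open>u\<close> is either the point \<open>p u\<close> or
      a segment from \<open>p u\<close>, and noncollinearity leaves \<open>p u\<close> as the only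
      common point.\<close>
    proof (cases "u \<in> s")
      case True
      then obtain b where b: "s = {u, b}" using small[OF s] by auto
      show ?thesis
      proof (cases "p b = p u")
        case False
        then have "\<not> collinear {p u, q, p b}"
          using q(2) s b by (auto simp: insert_commute)
        then show ?thesis using Int_segments_at_common_end[of "p u" q "p b"] b by auto
      qed (use b in auto)
    qed (use q(1) s in auto)
  qed
qed

lemma geometric_complexD:
  "geometric_complex p K \<Longrightarrow> s \<in> K \<Longrightarrow> t \<in> K \<Longrightarrow> s \<noteq> t \<Longrightarrow>
     convex hull (p ` s) \<inter> convex hull (p ` t) \<subseteq> p ` (s \<inter> t)"
  unfolding geometric_complex_def by simp

lemma geometric_complex_Un:
  assumes "geometric_complex p K" "geometric_complex p L"
    and "\<And>s t. s \<in> K \<Longrightarrow> t \<in> L \<Longrightarrow> convex hull (p ` s) \<inter> convex hull (p ` t) \<subseteq> p ` (s \<inter> t)"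
  shows "geometric_complex p (K \<union> L)"
  unfolding geometric_complex_def
proof (intro ballI impI)
  fix s t assume "s \<in> K \<union> L" "t \<in> K \<union> L" "s \<noteq> t"
  then consider "s \<in> K" "t \<in> K" | "s \<in> L" "t \<in> L" | "s \<in> K" "t \<in> L" | "t \<in> K" "s \<in> L"
    by blast
  then show "convex hull (p ` s) \<inter> convex hull (p ` t) \<subseteq> p ` (s \<inter> t)"
  proof cases
    case 1 then show ?thesis using geometric_complexD[OF assms(1)] \<open>s \<noteq> t\<close> by simp
  next
    case 2 then show ?thesis using geometric_complexD[OF assms(2)] \<open>s \<noteq> t\<close> by simp
  next
    case 3 then show ?thesis by (rule assms(3))
  next
    case 4 then show ?thesis using assms(3)[of t s] by (simp add: Int_commute)
  qed
qed

lemma geometric_complex_cong: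
  assumes "geometric_complex p K" "\<And>x. x \<in> \<Union>K \<Longrightarrow> p x = p' x"
  shows "geometric_complex p' K"
proof -
  have "p ` s = p' ` s" if "s \<subseteq> \<Union>K" for s
    using that by (intro image_cong refl assms(2)) (rule subsetD)
  then show ?thesis
    using assms(1) unfolding geometric_complex_def
    by (metis Union_upper inf.coboundedI1)
qed

text \<open>The point \<open>q\<close> is taken close to \<open>m\<close> and off all lines through
  two old vertices. Closeness and noncollinearity handle new against old simplices; two new edges
  share only \<open>q\<close> because \<open>q\<close> is off the line through their other
  ends.\<close>

lemma geometric_complex_extend:
  assumes K: "geometric_complex p K" "finite K" and small: "\<And>s. s \<in> K \<Longrightarrow> \<exists>x y. s = {x, y}"
    and w: "w \<notin> \<Union>K" and N: "N \<noteq> {}" "N \<subseteq> \<Union>K" "inj_on p N"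
    and m: "\<And>u s. u \<in> N \<Longrightarrow> s \<in> K \<Longrightarrow> u \<notin> s \<Longrightarrow> convex hull {p u, m} \<inter> convex hull (p ` s) = {}"
  obtains q where "geometric_complex (p(w := q)) (K \<union> insert {w} ((\<lambda>u. {u, w}) ` N))"
proof -
  have finK: "finite (\<Union>K)" using K(2) small by fastforce
  then have "finite N" using N(2) finite_subset by blast
  have "\<forall>\<^sub>F q in nhds m. \<forall>u\<in>N. (\<forall>b\<in>\<Union>K. p b \<noteq> p u \<longrightarrow> \<not> collinear {p u, p b, q}) \<longrightarrow>
           (\<forall>s\<in>K. convex hull {p u, q} \<inter> convex hull (p ` s) \<subseteq> p ` ({u} \<inter> s))"
    (is "eventually ?ok _")
    using \<open>finite N\<close> eventually_new_edge_ok[OF K(2) small m] by (simp add: eventually_ball_finite)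
  then obtain S where S: "open S" "m \<in> S" "\<forall>q\<in>S. ?ok q"
    unfolding eventually_nhds by (elim exE conjE)
  \<comment> \<open>the pairs \<open>(p u, p u + 1)\<close> only ensure that \<open>q\<close> differs from \<open>p u\<close>\<close>
  define L where "L = (p ` \<Union>K) \<times> (p ` \<Union>K) \<union> (\<lambda>u. (p u, p u + 1)) ` N"
  have "finite L" using finK \<open>finite N\<close> by (simp add: L_def)
  then obtain q where q: "q \<in> S" "\<And>a b. (a, b) \<in> L \<Longrightarrow> a \<noteq> b \<Longrightarrow> \<not> collinear {a, b, q}"
    using S(1,2) by (elim exists_off_lines[of L S]) auto
  have off: "\<not> collinear {p a, p b, q}" if "a \<in> \<Union>K" "b \<in> \<Union>K" "p a \<noteq> p b" for a b
    using q(2)[of "p a" "p b"] that by (auto simp: L_def)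
  have q_ne: "q \<noteq> p u" if "u \<in> N" for u
  proof
    assume "q = p u"
    then have "{p u, p u + 1, q} = {p u, p u + 1}" by blast
    then have "collinear {p u, p u + 1, q}" by (simp only: collinear_2)
    then show False using q(2)[of "p u" "p u + 1"] that by (auto simp: L_def)
  qed
  have old: "convex hull {p u, q} \<inter> convex hull (p ` s) \<subseteq> p ` ({u} \<inter> s)"
    if "u \<in> N" "s \<in> K" for u s
  proof -
    have "\<forall>b\<in>\<Union>K. p b \<noteq> p u \<longrightarrow> \<not> collinear {p u, p b, q}"
      using off[of u] that N(2) by (metis subsetD)
    then show ?thesis using S(3) q(1) that by simp
  qed
  let ?p = "p(w := q)"
  have p_old: "?p x = p x" if "x \<in> \<Union>K" for x using that w by auto
  have p_img: "?p ` s = p ` s" if "s \<subseteq> \<Union>K" for s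
    using that by (intro image_cong refl p_old) (rule subsetD)
  have p_new: "?p ` {u, w} = {p u, q}" if "u \<in> N" for u
  proof -
    have "u \<in> \<Union>K" using that N(2) by (rule subsetD[rotated])
    with w have "u \<noteq> w" by metis
    then show ?thesis by auto
  qed
  have "geometric_complex ?p (K \<union> insert {w} ((\<lambda>u. {u, w}) ` N))"
  proof (rule geometric_complex_Un)
    show "geometric_complex ?p K"
      by (rule geometric_complex_cong[OF K(1)]) (rule p_old[symmetric])
    show "geometric_complex ?p (insert {w} ((\<lambda>u. {u, w}) ` N))"
      unfolding geometric_complex_def
    proof (intro ballI impI)
      fix s t assume st: "s \<in> insert {w} ((\<lambda>u. {u, w}) ` N)" "t \<in> insert {w} ((\<lambda>u. {u, w}) ` N)"
        "s \<noteq> t"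
      show "convex hull (?p ` s) \<inter> convex hull (?p ` t) \<subseteq> ?p ` (s \<inter> t)"
      proof (cases "s = {w} \<or> t = {w}")
        case False
        then obtain u v where uv: "u \<in> N" "v \<in> N" "s = {u, w}" "t = {v, w}"
          using st(1,2) by (elim insertE imageE) simp_all
        then have "u \<noteq> v" using st(3) by auto
        then have "p u \<noteq> p v" using uv N(3) by (auto dest: inj_onD)
        then have "\<not> collinear {q, p u, p v}"
          using off[of u v] uv N(2) by (auto simp: insert_commute)
        then have "convex hull {p u, q} \<inter> convex hull {p v, q} = {q}"
          using Int_segments_at_common_end by (simp add: insert_commute)
        moreover have "?p ` s = {p u, q}" "?p ` t = {p v, q}" using uv p_new by auto
        ultimately show ?thesis using uv by auto
      qed (use st in auto)
    qed
    fix s t assume s: "s \<in> K" and t: "t \<in> insert {w} ((\<lambda>u. {u, w}) ` N)"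
    have ps: "?p ` s = p ` s" using s by (intro p_img) auto
    show "convex hull (?p ` s) \<inter> convex hull (?p ` t) \<subseteq> ?p ` (s \<inter> t)"
    proof (cases "t = {w}")
      case True
      obtain u where "u \<in> N" using N(1) by blast
      \<comment> \<open>The point \<open>q\<close> lies on the new segment from \<open>p u\<close>,
        which meets old simplices at most in \<open>p u\<close>, and \<open>q\<close> differs from
        \<open>p u\<close>.\<close>
      have "q \<notin> convex hull (p ` s)"
      proof
        assume "q \<in> convex hull (p ` s)"
        moreover have "q \<in> convex hull {p u, q}" by (simp add: hull_inc)
        ultimately have "q \<in> p ` ({u} \<inter> s)" using old[OF \<open>u \<in> N\<close> s] by blast
        then show False using q_ne[OF \<open>u \<in> N\<close>] by auto
      qed
      then show ?thesis using True ps by simp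
    next
      case False
      then obtain u where u: "u \<in> N" "t = {u, w}" using t by (elim insertE imageE) simp_all
      have "s \<inter> t = {u} \<inter> s" using u s w by auto
      moreover have "?p ` ({u} \<inter> s) = p ` ({u} \<inter> s)" using s by (intro p_img) auto
      moreover have "?p ` t = {p u, q}" using p_new u by simp
      ultimately show ?thesis using old[OF u(1) s] ps by (simp add: Int_commute)
    qed
  qed
  then show ?thesis by (rule that)
qed

text \<open>The simplices drawn so far cover a bounded set, so there is always a point off all of
  them for the next isolated vertex.\<close>

lemma geometric_complex_add_isolated:
  assumes "finite U" "geometric_complex p K" "finite K" "\<And>s. s \<in> K \<Longrightarrow> finite s" "U \<inter> \<Union>K = {}"
  shows "\<exists>p. geometric_complex p (K \<union> (\<lambda>v. {v}) ` U)"
  using assms(1,5)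
proof (induction U rule: finite_induct)
  case empty
  then show ?case using assms(2) by auto
next
  case (insert x U)
  let ?K = "K \<union> (\<lambda>v. {v}) ` U"
  obtain p where p: "geometric_complex p ?K" using insert by auto
  have "bounded (\<Union>s\<in>?K. convex hull (p ` s))"
  proof (rule bounded_UN)
    show "\<forall>s\<in>?K. bounded (convex hull (p ` s))"
      using assms(4) by (auto simp: bounded_convex_hull finite_imp_bounded)
  qed (use assms(3) insert(1) in auto)
  then obtain q where q: "q \<notin> (\<Union>s\<in>?K. convex hull (p ` s))"
    using not_bounded_UNIV by (metis UNIV_eq_I)
  have x: "x \<notin> \<Union>?K" using insert by auto
  have "geometric_complex (p(x := q)) (?K \<union> {{x}})"
  proof (rule geometric_complex_Un)
    show "geometric_complex (p(x := q)) ?K"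
      using p x by (intro geometric_complex_cong[OF p]) auto
    fix s t assume s: "s \<in> ?K" and t: "t \<in> {{x}}"
    have "p(x := q) ` s = p ` s" using s x by (intro image_cong) auto
    then show "convex hull (p(x := q) ` s) \<inter> convex hull (p(x := q) ` t) \<subseteq> p(x := q) ` (s \<inter> t)"
      using q s t by auto
  qed (simp add: geometric_complex_def)
  then show ?case by (auto simp: insert_commute)
qed

subsection \<open>Graphs with at most nine edges\<close>

lemma in_segment_coords:
  assumes "z \<in> convex hull {a, b}"
  obtains t where "0 \<le> t" "t \<le> 1" "Re z = Re a + t * (Re b - Re a)" "Im z = Im a + t * (Im b - Im a)"
proof -
  obtain t where t: "0 \<le> t" "t \<le> 1" and z: "z = (1 - t) *\<^sub>R a + t *\<^sub>R b"
    using assms by (auto simp: segment_convex_hull[symmetric] in_segment)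
  have "Re z = Re a + t * (Re b - Re a)" "Im z = Im a + t * (Im b - Im a)"
    unfolding z by (simp_all add: algebra_simps)
  with t show ?thesis by (rule that)
qed

text \<open>The missing edge is \<open>{X, Y}\<close>. \<open>X\<close> lies inside the triangle
  \<open>A B C\<close>; \<open>Y\<close> lies outside it and sees all three corners, since
  \<open>B\<close> is interior to the triangle \<open>Y A C\<close>.\<close>

lemma K5_minus_edge_geometric:
  defines "A \<equiv> Complex (-3) (-3)" and "B \<equiv> 0" and "C \<equiv> Complex 3 (-3)"
    and "X \<equiv> Complex 0 (-1)" and "Y \<equiv> Complex 0 3"
  shows "geometric_complex id {{A}, {B}, {C}, {X}, {Y}, {A, B}, {B, C}, {C, A},
           {X, A}, {X, B}, {X, C}, {Y, A}, {Y, B}, {Y, C}}" (is "geometric_complex id ?K")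
proof -
  note pts = A_def B_def C_def X_def Y_def
  \<comment> \<open>Each edge is confined by the equation of its line and bounds on one coordinate,
    so that comparing two edges becomes linear arithmetic.\<close>
  have AB: "Re z = Im z \<and> -3 \<le> Re z \<and> Re z \<le> 0" if "z \<in> convex hull {A, B}" for z
    using that by (rule in_segment_coords) (simp add: pts)
  have BC: "Re z = - Im z \<and> 0 \<le> Re z \<and> Re z \<le> 3" if "z \<in> convex hull {B, C}" for z
    using that by (rule in_segment_coords) (simp add: pts)
  have CA: "Im z = -3 \<and> -3 \<le> Re z \<and> Re z \<le> 3" if "z \<in> convex hull {C, A}" for z
    using that by (rule in_segment_coords) (simp add: pts)
  have XA: "3 * Im z + 3 = 2 * Re z \<and> -3 \<le> Re z \<and> Re z \<le> 0" if "z \<in> convex hull {X, A}" for z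
    using that by (rule in_segment_coords) (simp add: pts)
  have XB: "Re z = 0 \<and> -1 \<le> Im z \<and> Im z \<le> 0" if "z \<in> convex hull {X, B}" for z
    using that by (rule in_segment_coords) (simp add: pts)
  have XC: "3 * Im z + 3 = -2 * Re z \<and> 0 \<le> Re z \<and> Re z \<le> 3" if "z \<in> convex hull {X, C}" for z
    using that by (rule in_segment_coords) (simp add: pts)
  have YA: "Im z - 3 = 2 * Re z \<and> -3 \<le> Re z \<and> Re z \<le> 0" if "z \<in> convex hull {Y, A}" for z
    using that by (rule in_segment_coords) (simp add: pts)
  have YB: "Re z = 0 \<and> 0 \<le> Im z \<and> Im z \<le> 3" if "z \<in> convex hull {Y, B}" for z
    using that by (rule in_segment_coords) (simp add: pts)
  have YC: "Im z - 3 = -2 * Re z \<and> 0 \<le> Re z \<and> Re z \<le> 3" if "z \<in> convex hull {Y, C}" for z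
    using that by (rule in_segment_coords) (simp add: pts)
  have eqs: "z = A \<longleftrightarrow> Re z = -3 \<and> Im z = -3" "z = B \<longleftrightarrow> Re z = 0 \<and> Im z = 0"
    "z = C \<longleftrightarrow> Re z = 3 \<and> Im z = -3" "z = X \<longleftrightarrow> Re z = 0 \<and> Im z = -1"
    "z = Y \<longleftrightarrow> Re z = 0 \<and> Im z = 3" for z
    by (auto simp: pts complex_eq_iff)
  have verts: "z \<in> convex hull {v} \<Longrightarrow> z = v" for v z :: complex by simp
  have *: "s = t \<or> z \<in> s \<inter> t" if "s \<in> ?K" "t \<in> ?K" "z \<in> convex hull s" "z \<in> convex hull t"
    for s t z
    using that
    \<comment> \<open>196 pairs of simplices, each settled by linear arithmetic on the two coordinates\<close>
    apply (elim insertE emptyE)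
    apply (((hypsubst_thin+)[1], rule disjI1, rule refl |
         (hypsubst_thin+)[1], rule disjI2, (unfold Int_iff insert_iff empty_iff)[1],
         ((drule AB | drule BC | drule CA | drule XA | drule XB | drule XC | drule YA | drule YB
          | drule YC | drule verts)+)[1], (unfold eqs)[1], arith)+)
    done
  show ?thesis
    unfolding geometric_complex_def image_id id_apply
  proof (intro ballI impI subsetI)
    fix s t z assume st: "s \<in> ?K" "t \<in> ?K" "s \<noteq> t" and "z \<in> convex hull s \<inter> convex hull t"
    then have "z \<in> convex hull s" "z \<in> convex hull t" by auto
    from *[OF st(1,2) this] st(3) show "z \<in> s \<inter> t" by satx
  qed
qed

lemma graph_mono: "graph V E \<Longrightarrow> F \<subseteq> E \<Longrightarrow> graph V F"
  unfolding graph_def by blast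

lemma graph_edge_subset: "graph V E \<Longrightarrow> e \<in> E \<Longrightarrow> e \<subseteq> V"
  unfolding graph_def by fastforce

lemma graph_finite_edges:
  assumes "graph V E" shows "finite E"
proof -
  have "E \<subseteq> Pow V" using graph_edge_subset[OF assms] by blast
  then show ?thesis using assms finite_subset unfolding graph_def by blast
qed

lemma graph_card_edge:
  assumes "graph V E" "e \<in> E" shows "card e = 2"
proof -
  obtain u v where "u \<noteq> v" "e = {u, v}" using assms unfolding graph_def by blast
  then show ?thesis by simp
qed

lemma graph_support: 
  assumes "graph V E" shows "graph (\<Union>E) E"
  unfolding graph_def
proof
  show "finite (\<Union>E)"
    using assms graph_edge_subset[OF assms] finite_subset[of "\<Union>E" V] unfolding graph_def by blast
  show "\<forall>e\<in>E. \<exists>u v. u \<in> \<Union>E \<and> v \<in> \<Union>E \<and> u \<noteq> v \<and> e = {u, v}"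
  proof
    fix e assume e: "e \<in> E"
    then obtain u v where "u \<noteq> v" "e = {u, v}" using assms unfolding graph_def by blast
    then have "u \<in> \<Union>E \<and> v \<in> \<Union>E \<and> u \<noteq> v \<and> e = {u, v}" using e by auto
    then show "\<exists>u v. u \<in> \<Union>E \<and> v \<in> \<Union>E \<and> u \<noteq> v \<and> e = {u, v}" by iprover
  qed
qed

text \<open>Injectivity on \<open>W\<close> preserves distinctness and intersections of simplices,
  so the coordinate model carries over to abstract vertices.\<close>

lemma geometric_complex_pull_back:
  assumes "inj_on p W" "\<And>s. s \<in> L \<Longrightarrow> s \<subseteq> W" "geometric_complex id K" "\<And>s. s \<in> L \<Longrightarrow> p ` s \<in> K"
  shows "geometric_complex p L"
  unfolding geometric_complex_def
proof (intro ballI impI)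
  fix s t assume st: "s \<in> L" "t \<in> L" "s \<noteq> t"
  then have "p ` s \<noteq> p ` t"
    using assms(1,2) by (simp add: inj_on_image_eq_iff)
  then have "convex hull (p ` s) \<inter> convex hull (p ` t) \<subseteq> p ` s \<inter> p ` t"
    using geometric_complexD[OF assms(3), of "p ` s" "p ` t"] assms(4) st by simp
  also have "\<dots> = p ` (s \<inter> t)"
    using assms(1,2) st by (simp add: inj_on_image_Int)
  finally show "convex hull (p ` s) \<inter> convex hull (p ` t) \<subseteq> p ` (s \<inter> t)" .
qed

text \<open>With five vertices, a nonadjacent pair \<open>x\<close>, \<open>y\<close> is sent to
  \<open>X\<close>, \<open>Y\<close>, the only pair of model points that is not joined.\<close>

lemma subgraph_of_K5_minus_edge:
  assumes G: "graph W E" and W: "card W \<le> 5"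
    and xy: "card W = 5 \<Longrightarrow> \<exists>x\<in>W. \<exists>y\<in>W. x \<noteq> y \<and> {x, y} \<notin> E"
  shows "\<exists>p. geometric_complex p (E \<union> (\<lambda>v. {v}) ` W)"
proof -
  define A B C X Y where "A = Complex (-3) (-3)" "B = (0::complex)" "C = Complex 3 (-3)"
    "X = Complex 0 (-1)" "Y = Complex 0 3"
  note pts = this
  have finW: "finite W" using G by (simp add: graph_def)
  obtain p where p: "inj_on p W" "p ` W \<subseteq> {A, B, C, X, Y}" "\<And>e. e \<in> E \<Longrightarrow> p ` e \<noteq> {X, Y}"
  proof (cases "card W = 5")
    case False
    \<comment> \<open>At most four vertices fit on \<open>A\<close>, \<open>B\<close>,
      \<open>C\<close>, \<open>X\<close>, which are pairwise joined, so any injection will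
      do.\<close>
    have "card {A, B, C, X} = 4" by (simp add: pts complex_eq_iff)
    then obtain p where p: "p ` W \<subseteq> {A, B, C, X}" "inj_on p W"
      using card_le_inj[OF finW, of "{A, B, C, X}"] False W by auto
    have "Y \<notin> {A, B, C, X}" by (simp add: pts complex_eq_iff)
    then have "p ` e \<noteq> {X, Y}" if "e \<in> E" for e
      using graph_edge_subset[OF G that] p(1) by blast
    then show ?thesis using p by (intro that[of p]) auto
  next
    case True
    then obtain x y where xy: "x \<in> W" "y \<in> W" "x \<noteq> y" "{x, y} \<notin> E" using xy by blast
    have "card {A, B, C} = 3" by (simp add: pts complex_eq_iff)
    moreover have "card (W - {x, y}) = 3" using xy True by (simp add: card_Diff_subset)
    ultimately obtain g where g: "g ` (W - {x, y}) \<subseteq> {A, B, C}" "inj_on g (W - {x, y})"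
      using card_le_inj[of "W - {x, y}" "{A, B, C}"] finW by auto
    have new: "X \<notin> {A, B, C}" "Y \<notin> {A, B, C}" "X \<noteq> Y" by (simp_all add: pts complex_eq_iff)
    define p where "p = g(x := X, y := Y)"
    have px: "p x = X" "p y = Y" using xy by (simp_all add: p_def)
    have pg: "p v = g v" if "v \<in> W - {x, y}" for v using that by (simp add: p_def)
    have pABC: "p v \<in> {A, B, C}" if "v \<in> W - {x, y}" for v using pg g(1) that by auto
    have "inj_on p (W - {x, y})" using g(2) inj_on_cong[of "W - {x, y}" p g] pg by simp
    then have "inj_on p (insert x (insert y (W - {x, y})))"
      using px pABC new by (auto simp: inj_on_insert)
    moreover have "insert x (insert y (W - {x, y})) = W" using xy by blast
    ultimately have "inj_on p W" by metis
    have "p ` W \<subseteq> {A, B, C, X, Y}"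
    proof
      fix z assume "z \<in> p ` W"
      then obtain v where "v \<in> W" "z = p v" by blast
      then show "z \<in> {A, B, C, X, Y}" using pABC[of v] px by (cases "v = x \<or> v = y") auto
    qed
    moreover have "p ` e \<noteq> {X, Y}" if "e \<in> E" for e
    proof
      assume "p ` e = {X, Y}"
      then have "p ` e = p ` {x, y}" using px by simp
      then have "e = {x, y}"
        using inj_on_image_eq_iff[OF \<open>inj_on p W\<close>, of e "{x, y}"] graph_edge_subset[OF G that] xy by simp
      then show False using that xy by simp
    qed
    ultimately show ?thesis using \<open>inj_on p W\<close> by (intro that[of p]) auto
  qed
  have "geometric_complex p (E \<union> (\<lambda>v. {v}) ` W)"
  proof (rule geometric_complex_pull_back[OF p(1) _ K5_minus_edge_geometric])
    fix s assume s: "s \<in> E \<union> (\<lambda>v. {v}) ` W"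
    then show "s \<subseteq> W" using graph_edge_subset[OF G] by blast
    show "p ` s \<in> {{Complex (-3) (-3)}, {0}, {Complex 3 (-3)}, {Complex 0 (-1)}, {Complex 0 3},
       {Complex (-3) (-3), 0}, {0, Complex 3 (-3)}, {Complex 3 (-3), Complex (-3) (-3)},
       {Complex 0 (-1), Complex (-3) (-3)}, {Complex 0 (-1), 0}, {Complex 0 (-1), Complex 3 (-3)},
       {Complex 0 3, Complex (-3) (-3)}, {Complex 0 3, 0}, {Complex 0 3, Complex 3 (-3)}}"
     
    proof (cases "s \<in> E")
      case True
      then obtain u v where uv: "u \<in> W" "v \<in> W" "u \<noteq> v" "s = {u, v}"
        using G unfolding graph_def by blast
      then have "p u \<noteq> p v" using p(1) by (auto dest: inj_onD)
      moreover have "p u \<in> {A, B, C, X, Y}" "p v \<in> {A, B, C, X, Y}" using uv p(2) by auto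
      moreover have "{p u, p v} \<noteq> {X, Y}" using p(3)[OF True] uv by simp
      moreover have "p ` s = {p u, p v}" using uv by simp
      ultimately show ?thesis
        unfolding pts[symmetric] by (elim insertE emptyE) (simp_all add: insert_commute)
    next
      case False
      then obtain v where "v \<in> W" "s = {v}" using s by blast
      then have "p v \<in> {A, B, C, X, Y}" "p ` s = {p v}" using p(2) by auto
      then show ?thesis unfolding pts[symmetric] by (elim insertE emptyE) simp_all
    qed
  qed
  then show ?thesis by (rule exI[of _ p])
qed

lemma card_2_otherE:
  assumes "card c = 2" "x \<in> c"
  obtains y where "x \<noteq> y" "c = {x, y}"
  using assms by (metis card_2_iff insertE insert_commute singletonD)

section \<open>Degree counting and the reduction of vertices of degree one and two\<close>

lemma handshake:
  assumes "graph V E"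
  shows "(\<Sum>v\<in>\<Union>E. card {e\<in>E. v \<in> e}) = 2 * card E"
proof -
  have fin: "finite E" "finite (\<Union>E)"
    using graph_finite_edges[OF assms] graph_support[OF assms] by (auto simp: graph_def)
  have "(\<Sum>v\<in>\<Union>E. card {e\<in>E. v \<in> e}) = (\<Sum>v\<in>\<Union>E. \<Sum>e | e \<in> E \<and> v \<in> e. 1)" by simp
  also have "\<dots> = (\<Sum>e\<in>E. \<Sum>v | v \<in> \<Union>E \<and> v \<in> e. 1)"
    using fin by (intro sum.swap_restrict) auto
  also have "\<dots> = (\<Sum>e\<in>E. 2)"
  proof (rule sum.cong)
    fix e assume e: "e \<in> E"
    then have "{v. v \<in> \<Union>E \<and> v \<in> e} = e" by blast
    then show "(\<Sum>v | v \<in> \<Union>E \<and> v \<in> e. 1) = (2::nat)"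
      using graph_card_edge[OF assms e] by simp
  qed simp
  finally show ?thesis by simp
qed

text \<open>Six or more vertices of degree at least 3 give a degree sum of at least 18, while twice
  the number of edges is at most 18. Equality then forces the excluded cubic graph with nine
  edges.\<close>

lemma min_degree_3_small_support:
  assumes G: "graph V E" and "card E \<le> 9"
    and deg: "\<And>v. v \<in> \<Union>E \<Longrightarrow> 3 \<le> card {e\<in>E. v \<in> e}"
    and not_cubic: "\<not> (card E = 9 \<and> (\<forall>v\<in>\<Union>E. card {e\<in>E. v \<in> e} = 3))"
  shows "card (\<Union>E) \<le> 5"
proof (rule ccontr)
  assume "\<not> card (\<Union>E) \<le> 5"
  then have 6: "6 \<le> card (\<Union>E)" by simp
  have fin: "finite (\<Union>E)" using graph_support[OF G] by (simp add: graph_def)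
  have sum: "(\<Sum>v\<in>\<Union>E. card {e\<in>E. v \<in> e}) = 2 * card E" by (rule handshake[OF G])
  have ge: "(\<Sum>v\<in>\<Union>E. 3) \<le> (\<Sum>v\<in>\<Union>E. card {e\<in>E. v \<in> e})" by (rule sum_mono) (rule deg)
  then have "card E = 9" "(\<Sum>v\<in>\<Union>E. 3) = (\<Sum>v\<in>\<Union>E. card {e\<in>E. v \<in> e})"
    using 6 sum \<open>card E \<le> 9\<close> by auto
  moreover have "card {e\<in>E. v \<in> e} = 3" if "v \<in> \<Union>E" for v
  proof (rule ccontr)
    assume "card {e\<in>E. v \<in> e} \<noteq> 3"
    then have "3 < card {e\<in>E. v \<in> e}" using deg[OF that] by simp
    then have "(\<Sum>v\<in>\<Union>E. 3) < (\<Sum>v\<in>\<Union>E. card {e\<in>E. v \<in> e})"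
      using fin that deg by (intro sum_strict_mono_ex1) blast+
    then show False using calculation by simp
  qed
  ultimately show False using not_cubic by blast
qed

text \<open>Five vertices span ten pairs, one more than there can be edges.\<close>

lemma missing_edge:
  assumes "graph W E" "card W = 5" "card E \<le> 9"
  shows "\<exists>x\<in>W. \<exists>y\<in>W. x \<noteq> y \<and> {x, y} \<notin> E"
proof (rule ccontr)
  assume none: "\<not> ?thesis"
  have "{s. s \<subseteq> W \<and> card s = 2} \<subseteq> E"
    using none by (auto simp: card_2_iff)
  then have "card {s. s \<subseteq> W \<and> card s = 2} \<le> card E"
    using graph_finite_edges[OF assms(1)] card_mono by blast
  moreover have "card {s. s \<subseteq> W \<and> card s = 2} = 10"
    using n_subsets[of W 2] assms(1,2) by (simp add: graph_def choose_two)
  ultimately show False using assms(3) by simp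
qed

text \<open>The leaf goes next to \<open>p u\<close>. The degenerate segment at \<open>p u\<close>
  misses every simplex without \<open>u\<close> because \<open>{u}\<close> is itself a simplex of
  the complex.\<close>

lemma add_leaf:
  assumes G: "graph V E" and w: "{e\<in>E. w \<in> e} = {{u, w}}" "u \<noteq> w"
    and p: "geometric_complex p (E - {{u, w}} \<union> (\<lambda>v. {v}) ` V)"
  shows "\<exists>p. geometric_complex p (E \<union> (\<lambda>v. {v}) ` V)"
proof -
  have uw: "{u, w} \<in> E" using w(1) by auto
  then have uV: "u \<in> V" using graph_edge_subset[OF G] by blast
  \<comment> \<open>The given drawing already places \<open>w\<close> somewhere; leaving out
    \<open>{w}\<close> frees it to be placed anew.\<close>
  define K where "K = E - {{u, w}} \<union> (\<lambda>v. {v}) ` (V - {w})"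
  have K: "geometric_complex p K"
    by (rule geometric_complex_mono[OF p]) (auto simp: K_def)
  have finK: "finite K" using graph_finite_edges[OF G] G by (simp add: K_def graph_def)
  have small: "\<exists>x y. s = {x, y}" if "s \<in> K" for s
    using that G unfolding K_def graph_def by blast
  have wK: "w \<notin> \<Union>K" using w(1) by (auto simp: K_def)
  have uK: "{u} \<in> K" using uV w(2) by (simp add: K_def)
  obtain q where "geometric_complex (p(w := q)) (K \<union> insert {w} ((\<lambda>u. {u, w}) ` {u}))"
  proof (rule geometric_complex_extend[OF K finK small wK, of "{u}" "p u"])
    show "{u} \<subseteq> \<Union>K" using uK by blast
    fix x s assume "x \<in> {u}" "s \<in> K" "x \<notin> s"
    then have "{u} \<noteq> s" "{u} \<inter> s = {}" "x = u" by auto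
    then show "convex hull {p x, p u} \<inter> convex hull (p ` s) = {}"
      using geometric_complexD[OF K uK \<open>s \<in> K\<close>] by simp
  qed auto
  moreover have "E \<union> (\<lambda>v. {v}) ` V \<subseteq> K \<union> insert {w} ((\<lambda>u. {u, w}) ` {u})"
    unfolding K_def by blast
  ultimately show ?thesis using geometric_complex_mono by blast
qed

lemma endpoint_not_in_half_segment:
  fixes a b :: complex
  assumes "a \<noteq> b"
  shows "b \<notin> convex hull {a, midpoint a b}"
proof
  assume "b \<in> convex hull {a, midpoint a b}"
  then have "dist a b \<le> dist a (midpoint a b)"
    using dist_in_closed_segment[of b a "midpoint a b"] by (simp add: segment_convex_hull dist_commute)
  then show False using assms by (simp add: dist_midpoint)
qed

text \<open>The vertex \<open>w\<close> goes near the midpoint of the segment for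
  \<open>{u, v}\<close> but off its line. The segment itself stays in the complex, so the case where
  \<open>{u, v}\<close> already belongs to \<open>E\<close> needs no separate treatment.\<close>

lemma add_degree_2_vertex:
  assumes G: "graph V E" and w: "{e\<in>E. w \<in> e} = {{u, w}, {v, w}}" "u \<noteq> w" "v \<noteq> w" "u \<noteq> v"
    and p: "geometric_complex p (insert {u, v} (E - {{u, w}, {v, w}}) \<union> (\<lambda>v. {v}) ` V)"
  shows "\<exists>p. geometric_complex p (E \<union> (\<lambda>v. {v}) ` V)"
proof -
  have "{u, w} \<in> E" "{v, w} \<in> E" using w(1) by auto
  then have uvV: "u \<in> V" "v \<in> V" using graph_edge_subset[OF G] by blast+
  define K where "K = insert {u, v} (E - {{u, w}, {v, w}}) \<union> (\<lambda>v. {v}) ` (V - {w})"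
  have K: "geometric_complex p K"
    by (rule geometric_complex_mono[OF p]) (auto simp: K_def)
  have finK: "finite K" using graph_finite_edges[OF G] G by (simp add: K_def graph_def)
  have small: "\<exists>x y. s = {x, y}" if "s \<in> K" for s
    using that G unfolding K_def graph_def by blast
  have wK: "w \<notin> \<Union>K" using w by (auto simp: K_def)
  have uvK: "{u} \<in> K" "{v} \<in> K" "{u, v} \<in> K" using uvV w by (simp_all add: K_def)
  have p_ne: "p u \<noteq> p v" using geometric_complexD[OF K uvK(1,2)] w(4) by auto
  \<comment> \<open>The half segment lies in the edge \<open>{x, y}\<close>, which meets a simplex
    without \<open>x\<close> at most in \<open>p y\<close>; and \<open>p y\<close> is beyond the
    midpoint.\<close>
  have half: "convex hull {p x, midpoint (p x) (p y)} \<inter> convex hull (p ` s) = {}"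
    if xy: "{x, y} = {u, v}" "x \<noteq> y" and s: "s \<in> K" "x \<notin> s" for x y s
  proof -
    have "p x \<noteq> p y" using p_ne xy by (auto simp: doubleton_eq_iff)
    have "s \<noteq> {u, v}" using s xy by auto
    then have 1: "convex hull (p ` {x, y}) \<inter> convex hull (p ` s) \<subseteq> p ` ({x, y} \<inter> s)"
      using geometric_complexD[OF K uvK(3) s(1)] xy(1) by simp
    have 2: "p ` ({x, y} \<inter> s) \<subseteq> {p y}" using s(2) by auto
    have 3: "convex hull {p x, midpoint (p x) (p y)} \<subseteq> convex hull (p ` {x, y})"
      using midpoint_in_closed_segment[of "p x" "p y"]
      by (simp add: segment_convex_hull hull_minimal hull_inc)
    have "convex hull {p x, midpoint (p x) (p y)} \<inter> convex hull (p ` s) \<subseteq> {p y}"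
      by (rule order_trans[OF Int_mono[OF 3 order_refl] order_trans[OF 1 2]])
    moreover have "p y \<notin> convex hull {p x, midpoint (p x) (p y)}"
      by (rule endpoint_not_in_half_segment[OF \<open>p x \<noteq> p y\<close>])
    ultimately show ?thesis by auto
  qed
  obtain q where "geometric_complex (p(w := q)) (K \<union> insert {w} ((\<lambda>u. {u, w}) ` {u, v}))"
  proof (rule geometric_complex_extend[OF K finK small wK, of "{u, v}" "midpoint (p u) (p v)"])
    show "{u, v} \<subseteq> \<Union>K" using uvK by blast
    show "inj_on p {u, v}" using p_ne by auto
    fix x s assume x: "x \<in> {u, v}" and s: "s \<in> K" "x \<notin> s"
    consider "x = u" | "x = v" using x by blast
    then show "convex hull {p x, midpoint (p u) (p v)} \<inter> convex hull (p ` s) = {}"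
    proof cases
      case 1 then show ?thesis using half[of u v s] s w(4) by simp
    next
      case 2
      with s have "v \<notin> s" by simp
      from half[OF insert_commute w(4)[symmetric] s(1) this] 2 show ?thesis
        by (simp only: midpoint_sym[of "p u"])
    qed
  qed auto
  moreover have "E \<union> (\<lambda>v. {v}) ` V \<subseteq> K \<union> insert {w} ((\<lambda>u. {u, w}) ` {u, v})"
    unfolding K_def by blast
  ultimately show ?thesis using geometric_complex_mono by blast
qed

text \<open>The excluded class contains the nonplanar graph K_{3,3}, which is cubic with nine
  edges.\<close>

lemma small_graph_straight_line_planar:
  assumes "graph V E" "card E \<le> 9"
    and "\<not> (card E = 9 \<and> (\<forall>v\<in>\<Union>E. card {e\<in>E. v \<in> e} = 3))"
  shows "\<exists>p. geometric_complex p (E \<union> (\<lambda>v. {v}) ` V)"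
  using assms
proof (induction "card E" arbitrary: E rule: less_induct)
  case less
  note G = less.prems(1)
  have finE: "finite E" by (rule graph_finite_edges[OF G])
  \<comment> \<open>A graph with fewer edges than \<open>E\<close> has fewer than nine, so the
    exceptional case cannot arise during the reduction.\<close>
  have IH: "\<exists>p. geometric_complex p (E' \<union> (\<lambda>v. {v}) ` V)"
    if "graph V E'" "card E' < card E" for E'
    using less.hyps[of E'] that less.prems(2) by simp
  consider (deg1) w where "card {e\<in>E. w \<in> e} = 1" | (deg2) w where "card {e\<in>E. w \<in> e} = 2"
    | (deg3) "\<And>v. v \<in> \<Union>E \<Longrightarrow> 3 \<le> card {e\<in>E. v \<in> e}"
  proof (cases "\<exists>w. card {e\<in>E. w \<in> e} = 1 \<or> card {e\<in>E. w \<in> e} = 2")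
    case False
    have "3 \<le> card {e\<in>E. v \<in> e}" if "v \<in> \<Union>E" for v
    proof -
      have "card {e\<in>E. v \<in> e} \<noteq> 0" using that finE by auto
      moreover have "card {e\<in>E. v \<in> e} \<noteq> 1" "card {e\<in>E. v \<in> e} \<noteq> 2" using False by auto
      ultimately show ?thesis by linarith
    qed
    then show ?thesis by (rule deg3)
  qed (use deg1 deg2 in blast)
  then show ?case
  proof cases
    case deg1
    then obtain e where e: "{e\<in>E. w \<in> e} = {e}" using card_1_singletonE by metis
    then have "e \<in> E" "w \<in> e" by auto
    then obtain u where u: "w \<noteq> u" "e = {w, u}" using card_2_otherE graph_card_edge[OF G] by metis
    have "card (E - {{u, w}}) < card E"
      using \<open>e \<in> E\<close> u finE by (intro psubset_card_mono) (auto simp: insert_commute)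
    then obtain p where "geometric_complex p (E - {{u, w}} \<union> (\<lambda>v. {v}) ` V)"
      using IH[OF graph_mono[OF G Diff_subset]] by metis
    then show ?thesis using add_leaf[OF G, of w u] e u by (simp add: insert_commute)
  next
    case deg2
    then obtain e f where ef: "{e\<in>E. w \<in> e} = {e, f}" "e \<noteq> f" using card_2_iff by metis
    then have "e \<in> E" "w \<in> e" "f \<in> E" "w \<in> f" by auto
    obtain u where u: "w \<noteq> u" "e = {w, u}"
      using card_2_otherE graph_card_edge[OF G \<open>e \<in> E\<close>] \<open>w \<in> e\<close> by metis
    obtain v where v: "w \<noteq> v" "f = {w, v}"
      using card_2_otherE graph_card_edge[OF G \<open>f \<in> E\<close>] \<open>w \<in> f\<close> by metis
    have "u \<noteq> v" using u v ef(2) by auto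
    have uvV: "u \<in> V" "v \<in> V"
      using graph_edge_subset[OF G \<open>e \<in> E\<close>] graph_edge_subset[OF G \<open>f \<in> E\<close>] u v by auto
    let ?E = "insert {u, v} (E - {e, f})"
    have "graph V (E - {e, f})" by (rule graph_mono[OF G Diff_subset])
    then have "graph V ?E" using uvV \<open>u \<noteq> v\<close> unfolding graph_def by blast
    moreover have "card {e, f} \<le> card E"
      using \<open>e \<in> E\<close> \<open>f \<in> E\<close> finE by (intro card_mono) auto
    then have "card (E - {e, f}) + 2 = card E"
      using \<open>e \<in> E\<close> \<open>f \<in> E\<close> ef(2) finE by (simp add: card_Diff_subset)
    then have "card ?E < card E" using finE by (simp add: card_insert_if)
    ultimately obtain p where "geometric_complex p (?E \<union> (\<lambda>v. {v}) ` V)"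
      using IH by metis
    then show ?thesis
      using add_degree_2_vertex[OF G, of w u v p] ef u v \<open>u \<noteq> v\<close> by (simp add: insert_commute)
  next
    case deg3
    have five: "card (\<Union>E) \<le> 5"
      by (rule min_degree_3_small_support[OF less.prems(1,2) deg3 less.prems(3)])
    have G': "graph (\<Union>E) E" by (rule graph_support[OF G])
    obtain p where p: "geometric_complex p (E \<union> (\<lambda>v. {v}) ` \<Union>E)"
      using subgraph_of_K5_minus_edge[OF G' five] missing_edge[OF G' _ less.prems(2)] by metis
    have sub: "\<Union>E \<subseteq> V" using graph_edge_subset[OF G] by blast
    have finV: "finite V" using G by (simp add: graph_def)
    let ?K = "E \<union> (\<lambda>v. {v}) ` \<Union>E"
    \<comment> \<open>The model places only the ends of edges; the isolated vertices of
      \<open>V\<close> are added afterwards.\<close>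
    have "\<exists>p. geometric_complex p (?K \<union> (\<lambda>v. {v}) ` (V - \<Union>E))"
    proof (rule geometric_complex_add_isolated[OF _ p])
      show "finite ?K" using finE finite_subset[OF sub finV] by simp
      show "finite s" if "s \<in> ?K" for s
        using that graph_edge_subset[OF G] finite_subset[OF _ finV] by auto
      show "(V - \<Union>E) \<inter> \<Union>?K = {}" by auto
    qed (use finV in simp)
    moreover have "E \<union> (\<lambda>v. {v}) ` V \<subseteq> ?K \<union> (\<lambda>v. {v}) ` (V - \<Union>E)" by auto
    ultimately show ?thesis using geometric_complex_mono by blast
  qed
qed

subsection \<open>Drawings in general position\<close>

text \<open>Injectivity is a separate demand because a set of two vertices contains no triple that
  would enforce it.\<close>

definition no_three_collinear :: "'a set \<Rightarrow> ('a \<Rightarrow> complex) \<Rightarrow> bool" where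
  "no_three_collinear V p \<longleftrightarrow> inj_on p V \<and> (\<forall>S\<subseteq>V. card S = 3 \<longrightarrow> \<not> collinear (p ` S))"

lemma no_three_collinearD:
  assumes "no_three_collinear V p" "a \<in> V" "b \<in> V" "c \<in> V" "a \<noteq> b" "a \<noteq> c" "b \<noteq> c"
  shows "\<not> collinear {p a, p b, p c}"
proof -
  have "{a, b, c} \<subseteq> V" "card {a, b, c} = 3" using assms by auto
  then have "\<not> collinear (p ` {a, b, c})" using assms(1) unfolding no_three_collinear_def by blast
  then show ?thesis by simp
qed

lemma vertex_not_on_segment:
  assumes "no_three_collinear V p" "e \<subseteq> V" "card e = 2" "v \<in> V" "p v \<in> convex hull (p ` e)"
  shows "v \<in> e"
proof (rule ccontr)
  assume "v \<notin> e"
  obtain a b where e: "e = {a, b}" "a \<noteq> b" using assms(3) by (meson card_2_iff)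
  then have "collinear {p a, p b, p v}" using assms(5) in_segment_collinear by simp
  then show False using no_three_collinearD[OF assms(1), of a b v] assms e \<open>v \<notin> e\<close> by auto
qed

text \<open>Two distinct common points would put all ends of \<open>e\<close> and \<open>f\<close>
  on one line. Since \<open>f\<close> has an end outside \<open>e\<close>, that line would carry
  three vertices.\<close>

lemma segments_meet_once:
  assumes "no_three_collinear V p" "e \<subseteq> V" "card e = 2" "f \<subseteq> V" "card f = 2" "e \<noteq> f"
    and x: "x \<in> convex hull (p ` e) \<inter> convex hull (p ` f)"
    and y: "y \<in> convex hull (p ` e) \<inter> convex hull (p ` f)"
  shows "x = y"
proof (rule ccontr)
  assume "x \<noteq> y"
  have on_line: "collinear {x, y, p v}" if v: "v \<in> g" and ef: "g = e \<or> g = f" for v g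
  proof -
    obtain a b where g: "g = {a, b}" using ef assms(3,5) by (meson card_2_iff)
    have "{x, y, p v} \<subseteq> convex hull (p ` g)"
      using x y v ef by (auto intro: hull_inc)
    then have "{x, y, p v} \<subseteq> closed_segment (p a) (p b)" using g by (simp add: segment_convex_hull)
    then show ?thesis using collinear_subset collinear_closed_segment by blast
  qed
  obtain a b where ab: "e = {a, b}" "a \<noteq> b" using assms(3) by (meson card_2_iff)
  have "\<not> f \<subseteq> e" using assms(3,5,6) ab(1) by (metis card_subset_eq finite.emptyI finite_insert)
  then obtain c where c: "c \<in> f" "c \<notin> e" by blast
  have "collinear {x, y, p a}" "collinear {x, y, p b}" "collinear {x, y, p c}"
    using on_line[of a e] on_line[of b e] on_line[of c f] ab(1) c(1) by simp_all
  then have "collinear (insert x (insert y {p a, p b, p c}))"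
    by (intro iffD2[OF collinear_triples[OF \<open>x \<noteq> y\<close>]]) blast
  then have "collinear {p a, p b, p c}" by (rule collinear_subset) auto
  then show False using no_three_collinearD[OF assms(1), of a b c] assms(2,4) ab c by auto
qed

definition open_seg :: "('a \<Rightarrow> complex) \<Rightarrow> 'a set \<Rightarrow> complex set" where
  "open_seg p e = convex hull (p ` e) - p ` e"

text \<open>All pairs of vertices count as edges. One placement thus serves every graph on
  \<open>V\<close>, and it can be built vertex by vertex.\<close>

definition general_position :: "'a set \<Rightarrow> ('a \<Rightarrow> complex) \<Rightarrow> bool" where
  "general_position V p \<longleftrightarrow> no_three_collinear V p \<and>
     (\<forall>e f g. e \<subseteq> V \<and> card e = 2 \<and> f \<subseteq> V \<and> card f = 2 \<and> g \<subseteq> V \<and> card g = 2 \<and>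
        e \<noteq> f \<and> e \<noteq> g \<and> f \<noteq> g \<longrightarrow> open_seg p e \<inter> open_seg p f \<inter> open_seg p g = {})"

lemma no_three_collinear_insert:
  assumes V: "no_three_collinear V p" and "w \<notin> V" and q: "q \<notin> p ` V"
    and off: "\<And>a b. a \<in> V \<Longrightarrow> b \<in> V \<Longrightarrow> a \<noteq> b \<Longrightarrow> \<not> collinear {p a, p b, q}"
  shows "no_three_collinear (insert w V) (p(w := q))"
  unfolding no_three_collinear_def
proof (intro conjI allI impI)
  have img: "p(w := q) ` S = p ` S" if "w \<notin> S" for S
    using that by auto
  have "inj_on p V" using V by (simp add: no_three_collinear_def)
  then have "inj_on (p(w := q)) V"
    by (rule iffD2[OF inj_on_cong[of V "p(w := q)" p], rotated]) (use \<open>w \<notin> V\<close> in auto)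
  then show "inj_on (p(w := q)) (insert w V)"
    using img[OF \<open>w \<notin> V\<close>] q \<open>w \<notin> V\<close> by (simp add: inj_on_insert)
  fix S assume S: "S \<subseteq> insert w V" "card S = 3"
  show "\<not> collinear (p(w := q) ` S)"
  proof (cases "w \<in> S")
    case False
    then have "S \<subseteq> V" using S by blast
    then show ?thesis using V S img[OF False] unfolding no_three_collinear_def by metis
  next
    case True
    then have "card (S - {w}) = 2" using S(2) by simp
    then obtain a b where ab: "S - {w} = {a, b}" "a \<noteq> b" by (meson card_2_iff)
    then have "a \<in> V" "b \<in> V" "a \<noteq> w" "b \<noteq> w" using S(1) by auto
    moreover have "S = {a, b, w}" using ab True by blast
    ultimately have "p(w := q) ` S = {p a, p b, q}" by auto
    then show ?thesis using off[OF \<open>a \<in> V\<close> \<open>b \<in> V\<close> ab(2)] by simp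
  qed
qed

text \<open>A new vertex is kept off the lines through two old vertices and off the lines through an
  old vertex and an old crossing point.\<close>

lemma exists_general_position:
  assumes "finite V"
  shows "\<exists>p. general_position V p"
  using assms
proof (induction V rule: finite_induct)
  case empty
  show ?case by (auto simp: general_position_def no_three_collinear_def)
next
  case (insert w V)
  then obtain p where p: "general_position V p" by blast
  then have nc: "no_three_collinear V p" by (simp add: general_position_def)
  define P where "P = {e. e \<subseteq> V \<and> card e = 2}"
  have finP: "finite P" using insert(1) by (simp add: P_def)
  \<comment> \<open>\<open>X\<close> collects the old crossing points, together with shared ends. It
    is finite because two segments meet at most once.\<close>
  define X where "X = (\<Union>(e, f)\<in>{(e, f)\<in>P \<times> P. e \<noteq> f}. convex hull (p ` e) \<inter> convex hull (p ` f))"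
  have "finite X"
    unfolding X_def
  proof (rule finite_UN_I)
    show "finite {(e, f)\<in>P \<times> P. e \<noteq> f}"
      by (rule finite_subset[of _ "P \<times> P"]) (use finP in auto)
    fix ef assume "ef \<in> {(e, f)\<in>P \<times> P. e \<noteq> f}"
    then obtain e f where ef: "ef = (e, f)" "e \<in> P" "f \<in> P" "e \<noteq> f" by blast
    have "\<forall>x\<in>convex hull (p ` e) \<inter> convex hull (p ` f).
        \<forall>y\<in>convex hull (p ` e) \<inter> convex hull (p ` f). x = y"
      using segments_meet_once[OF nc, of e f] ef(2-) unfolding P_def by blast
    then have "finite (convex hull (p ` e) \<inter> convex hull (p ` f))"
      by (metis finite.emptyI finite.insertI finite_subset singletonI subsetI ex_in_conv)
    then show "finite (case ef of (e, f) \<Rightarrow> convex hull (p ` e) \<inter> convex hull (p ` f))"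
      by (simp add: ef(1))
  qed
  \<comment> \<open>the pairs \<open>(p a, p a + 1)\<close> only ensure that \<open>q\<close> differs from \<open>p a\<close>\<close>
  define L where "L = p ` V \<times> (p ` V \<union> X) \<union> (\<lambda>a. (p a, p a + 1)) ` V"
  have "finite L" using \<open>finite X\<close> insert(1) by (simp add: L_def)
  then obtain q where q: "\<And>a b. (a, b) \<in> L \<Longrightarrow> a \<noteq> b \<Longrightarrow> \<not> collinear {a, b, q}"
    by (rule exists_off_lines[of L UNIV]) auto
  have off: "\<not> collinear {p a, x, q}" if "a \<in> V" "x \<in> p ` V \<union> X" "p a \<noteq> x" for a x
    using that by (intro q) (auto simp: L_def)
  have inj: "p a \<noteq> p b" if "a \<in> V" "b \<in> V" "a \<noteq> b" for a b
    using that nc by (auto simp: no_three_collinear_def dest: inj_onD)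
  have q_new: "q \<notin> p ` V"
  proof
    assume "q \<in> p ` V"
    then obtain a where a: "a \<in> V" "q = p a" by blast
    then have "collinear {p a, p a + 1, q}" by (simp add: insert_commute)
    then show False using q[of "p a" "p a + 1"] a by (auto simp: L_def)
  qed
  define p' where "p' = p(w := q)"
  have nc': "no_three_collinear (insert w V) p'"
    unfolding p'_def
    by (rule no_three_collinear_insert[OF nc insert(2) q_new]) (use off inj in auto)
  have old: "open_seg p' e = open_seg p e" if "w \<notin> e" for e
  proof -
    have "p' ` e = p ` e" using that unfolding p'_def by auto
    then show ?thesis by (simp add: open_seg_def)
  qed
  have new: "\<exists>a\<in>V. e = {a, w} \<and> p' ` e = {p a, q}"
    if "e \<subseteq> insert w V" "card e = 2" "w \<in> e" for e
  proof -
    have "card (e - {w}) = 1" using that by simp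
    then obtain a where "e - {w} = {a}" using card_1_singletonE by blast
    then have "e = {a, w}" "a \<noteq> w" "a \<in> V" using that by auto
    then show ?thesis unfolding p'_def by (intro bexI[of _ a]) auto
  qed
  \<comment> \<open>Two segments ending at the new vertex share only \<open>q\<close>, which is not
    in their open parts.\<close>
  have two: False if e: "e \<subseteq> insert w V" "card e = 2" "w \<in> e"
    and f: "f \<subseteq> insert w V" "card f = 2" "w \<in> f" and "e \<noteq> f" "z \<in> open_seg p' e" "z \<in> open_seg p' f" for e f z
  proof -
    obtain a where a: "a \<in> V" "e = {a, w}" "p' ` e = {p a, q}" using new[OF e] by blast
    obtain b where b: "b \<in> V" "f = {b, w}" "p' ` f = {p b, q}" using new[OF f] by blast
    have "a \<noteq> b" using a b that by auto
    then have "\<not> collinear {q, p a, p b}"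
      using off[of a "p b"] inj a b by (simp add: insert_commute)
    then have "convex hull {p a, q} \<inter> convex hull {p b, q} = {q}"
      using Int_segments_at_common_end by (simp add: insert_commute)
    then show False using that(8,9) a b unfolding open_seg_def by auto
  qed
  \<comment> \<open>A new segment from \<open>p a\<close> through an old crossing \<open>z\<close>
    would put \<open>q\<close> on the line through \<open>p a\<close> and \<open>z\<close>.\<close>
  have one: False if e: "e \<subseteq> insert w V" "card e = 2" "w \<in> e" and "f \<subseteq> V" "card f = 2"
    "g \<subseteq> V" "card g = 2" "f \<noteq> g" "z \<in> open_seg p' e" "z \<in> open_seg p' f" "z \<in> open_seg p' g" for e f g z
  proof -
    obtain a where a: "a \<in> V" "e = {a, w}" "p' ` e = {p a, q}" using new[OF e] by blast
    have "w \<notin> f" "w \<notin> g" using that insert(2) by auto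
    then have z: "z \<in> open_seg p f" "z \<in> open_seg p g" using old that by auto
    then have "z \<in> X" unfolding X_def P_def open_seg_def using that by blast
    moreover have "p a \<noteq> z"
      using vertex_not_on_segment[OF nc that(4,5) a(1)] z(1) unfolding open_seg_def by blast
    ultimately have "\<not> collinear {p a, z, q}" using off a by blast
    moreover have "collinear {p a, q, z}"
      using that(9) a in_segment_collinear unfolding open_seg_def by simp
    ultimately show False by (simp add: insert_commute)
  qed
  have "open_seg p' e \<inter> open_seg p' f \<inter> open_seg p' g = {}"
    if e: "e \<subseteq> insert w V" "card e = 2" and f: "f \<subseteq> insert w V" "card f = 2"
      and g: "g \<subseteq> insert w V" "card g = 2" and ne: "e \<noteq> f" "e \<noteq> g" "f \<noteq> g" for e f g
  proof (rule ccontr)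
    assume "open_seg p' e \<inter> open_seg p' f \<inter> open_seg p' g \<noteq> {}"
    then obtain z where z: "z \<in> open_seg p' e" "z \<in> open_seg p' f" "z \<in> open_seg p' g" by blast
    have sub: "h \<subseteq> V" if "h \<subseteq> insert w V" "w \<notin> h" for h using that by blast
    consider "w \<in> e" "w \<in> f" | "w \<in> e" "w \<in> g" | "w \<in> f" "w \<in> g"
      | "w \<in> e" "w \<notin> f" "w \<notin> g" | "w \<notin> e" "w \<in> f" "w \<notin> g" | "w \<notin> e" "w \<notin> f" "w \<in> g"
      | "w \<notin> e" "w \<notin> f" "w \<notin> g" by blast
    then show False
    proof cases
      case 1 then show ?thesis using two[of e f z] e f ne z by simp
    next
      case 2 then show ?thesis using two[of e g z] e g ne z by simp
    next
      case 3 then show ?thesis using two[of f g z] f g ne z by simp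
    next
      case 4 then show ?thesis using one[of e f g z] e f g ne z sub by simp
    next
      case 5 then show ?thesis using one[of f e g z] e f g ne z sub by simp
    next
      case 6 then show ?thesis using one[of g e f z] e f g ne z sub by simp
    next
      case 7
      then have "open_seg p e \<inter> open_seg p f \<inter> open_seg p g = {}"
        using p e f g ne sub unfolding general_position_def by simp
      then show ?thesis using z old 7 by blast
    qed
  qed
  with nc' have "general_position (insert w V) p'"
    unfolding general_position_def by simp
  then show ?case by (rule exI[of _ p'])
qed

text \<open>Without this, \<open>cr\<close> would be a \<open>LEAST\<close> over an empty predicate and carry no information.\<close>

lemma exists_simple_drawing:
  assumes G: "graph V E"
  shows "\<exists>p \<gamma>. simple_drawing V E p \<gamma>"
proof -
  obtain p where p: "general_position V p"
    using exists_general_position G by (auto simp: graph_def)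
  then have nc: "no_three_collinear V p" by (simp add: general_position_def)
  have E: "e \<subseteq> V \<and> card e = 2" if "e \<in> E" for e
    using graph_edge_subset[OF G that] graph_card_edge[OF G that] by simp
  have seg: "edge_interior p (straight p) e = open_seg p e" if "e \<in> E" for e
    using edge_interior_straight[OF G that] by (simp add: open_seg_def)
  have "drawing V E p (straight p)"
  proof (rule straight_drawing[OF G])
    show "inj_on p V" using nc by (simp add: no_three_collinear_def)
    show "v \<in> e" if "e \<in> E" "v \<in> V" "p v \<in> convex hull (p ` e)" for e v
      using vertex_not_on_segment[OF nc] E that by blast
  qed
  moreover have "x = y" if "e \<in> E" "f \<in> E" "e \<noteq> f"
    "x \<in> edge_interior p (straight p) e \<inter> edge_interior p (straight p) f"
    "y \<in> edge_interior p (straight p) e \<inter> edge_interior p (straight p) f" for e f x y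
    using segments_meet_once[OF nc, of e f x y] E[OF that(1)] E[OF that(2)] that
    by (simp add: seg open_seg_def)
  moreover have "edge_interior p (straight p) e \<inter> edge_interior p (straight p) f
      \<inter> edge_interior p (straight p) g = {}"
    if "e \<in> E" "f \<in> E" "g \<in> E" "e \<noteq> f \<and> e \<noteq> g \<and> f \<noteq> g" for e f g
    using p E that unfolding general_position_def by (simp add: seg)
  ultimately have "simple_drawing V E p (straight p)"
    unfolding simple_drawing_def by (intro conjI ballI impI allI)
  then show ?thesis by (intro exI)
qed

subsection \<open>Covers of the conflict graph\<close>

lemma exists_small_cover:
  assumes "finite C" "\<And>c. c \<in> C \<Longrightarrow> c \<noteq> {}"
  obtains F where "F \<subseteq> \<Union>C" "finite F" "card F \<le> card C" "\<And>c. c \<in> C \<Longrightarrow> c \<inter> F \<noteq> {}"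
proof
  let ?F = "(\<lambda>c. SOME x. x \<in> c) ` C"
  have *: "(SOME x. x \<in> c) \<in> c" if "c \<in> C" for c
    using assms(2)[OF that] some_in_eq by blast
  show "?F \<subseteq> \<Union>C" "finite ?F" "card ?F \<le> card C" using * assms by (auto simp: card_image_le)
  show "c \<inter> ?F \<noteq> {}" if "c \<in> C" for c using * that by blast
qed

text \<open>The vertex \<open>x\<close> covers all its edges at once and every other edge
  contributes one vertex. A vertex of degree k thus saves k - 1 against one vertex per edge.\<close>

lemma cover_through_vertex:
  assumes "finite C" "\<And>c. c \<in> C \<Longrightarrow> c \<noteq> {}"
  obtains F where "F \<subseteq> insert x (\<Union>C)" "finite F" "card F + card {c\<in>C. x \<in> c} \<le> card C + 1"
    "\<And>c. c \<in> C \<Longrightarrow> c \<inter> F \<noteq> {}"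
proof -
  let ?D = "{c\<in>C. x \<in> c}"
  obtain F where F: "F \<subseteq> \<Union>(C - ?D)" "finite F" "card F \<le> card (C - ?D)"
    "\<And>c. c \<in> C - ?D \<Longrightarrow> c \<inter> F \<noteq> {}"
    by (rule exists_small_cover[of "C - ?D"]) (use assms in auto)
  have "card (C - ?D) + card ?D = card C"
    using assms(1) by (simp add: card_Diff_subset card_mono)
  moreover have "card (insert x F) \<le> card F + 1"
    by (simp add: card_insert_le_m1 card_insert_if F(2))
  ultimately show ?thesis
    using that[of "insert x F"] F by auto
qed

text \<open>One end is chosen from each edge, and disjointness keeps the choices for other edges out
  of \<open>c\<close>. Meeting every edge in exactly one point makes \<open>T\<close> a colour
  class.\<close>

lemma matching_transversal:
  assumes "\<And>c. c \<in> M \<Longrightarrow> c \<noteq> {}" "pairwise disjnt M"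
  obtains T where "T \<subseteq> \<Union>M" "\<And>c. c \<in> M \<Longrightarrow> \<exists>x. c \<inter> T = {x}"
proof
  let ?f = "\<lambda>c. SOME x. x \<in> c"
  have *: "?f c \<in> c" if "c \<in> M" for c
    using assms(1)[OF that] some_in_eq by blast
  show "?f ` M \<subseteq> \<Union>M" using * by blast
  show "\<exists>x. c \<inter> ?f ` M = {x}" if "c \<in> M" for c
  proof
    show "c \<inter> ?f ` M = {?f c}"
      using * that assms(2) by (fastforce simp: pairwise_def disjnt_iff)
  qed
qed

text \<open>Compared with one vertex per edge, a cover has to save two. Where the degrees do not
  allow this, the graph is a matching, or a path with two edges plus a matching on the remaining
  edges, and only a triangle prevents a 2-colouring.\<close>

lemma bipartite_or_cover:
  assumes fin: "finite C" and two: "\<And>c. c \<in> C \<Longrightarrow> card c = 2"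
  obtains (bipartite) X where "\<And>c. c \<in> C \<Longrightarrow> \<exists>x. c \<inter> X = {x}"
  | (cover) F where "F \<subseteq> \<Union>C" "card F + 2 \<le> card C" "\<And>c. c \<in> C \<Longrightarrow> c \<inter> F \<noteq> {}"
  | (exchange) S a b where "S \<subseteq> \<Union>C" "a \<in> \<Union>C" "b \<in> \<Union>C" "a \<notin> S" "b \<notin> S" "a \<noteq> b"
      "card S + 2 \<le> card C"
      "\<And>c. c \<in> C \<Longrightarrow> c \<inter> insert a S \<noteq> {}" "\<And>c. c \<in> C \<Longrightarrow> c \<inter> insert b S \<noteq> {}"
proof -
  have ne: "c \<noteq> {}" if "c \<in> C" for c using two[OF that] by auto
  define d where "d x = {c\<in>C. x \<in> c}" for x
  have find: "finite (d x)" for x unfolding d_def using fin by simp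
  show ?thesis
  proof (cases "pairwise disjnt C")
    case True
    then show ?thesis using matching_transversal ne bipartite by metis
  next
    case False
    then obtain c1 c2 x where c: "c1 \<in> C" "c2 \<in> C" "c1 \<noteq> c2" "x \<in> c1" "x \<in> c2"
      by (auto simp: pairwise_def disjnt_iff)
    obtain y where y: "x \<noteq> y" "c1 = {x, y}" using card_2_otherE two c by metis
    obtain z where z: "x \<noteq> z" "c2 = {x, z}" using card_2_otherE two c by metis
    have yz: "c1 = {x, y}" "c2 = {x, z}" "x \<noteq> y" "x \<noteq> z" "y \<noteq> z"
      using y z c by auto
    have sub: "{c1, c2} \<subseteq> d x" using c by (auto simp: d_def)
    show ?thesis
    proof (cases "d x = {c1, c2}")
      case False
      \<comment> \<open>A vertex of degree at least three saves two by itself.\<close>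
      then have "card {c1, c2} < card (d x)"
        using sub find by (intro psubset_card_mono) auto
      then have "3 \<le> card (d x)" using c by simp
      moreover obtain F where F: "F \<subseteq> insert x (\<Union>C)" "finite F"
        "card F + card (d x) \<le> card C + 1" "\<And>c. c \<in> C \<Longrightarrow> c \<inter> F \<noteq> {}"
        unfolding d_def by (rule cover_through_vertex[OF fin ne, of x]) auto
      moreover have "x \<in> \<Union>C" using c by blast
      ultimately have "F \<subseteq> \<Union>C" "card F + 2 \<le> card C" by auto
      then show ?thesis using F(4) by (rule cover)
    next
      case dx: True
      define R where "R = C - {c1, c2}"
      have xR: "x \<notin> \<Union>R" using dx unfolding d_def R_def by blast
      have finR: "finite R" and neR: "\<And>c. c \<in> R \<Longrightarrow> c \<noteq> {}"
        using fin ne by (auto simp: R_def)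
      have "card {c1, c2} \<le> card C" using c fin by (intro card_mono) auto
      then have cardR: "card R + 2 = card C"
        using c fin by (simp add: R_def card_Diff_subset)
      show ?thesis
      proof (cases "pairwise disjnt R")
        case False
        \<comment> \<open>Here \<open>x\<close> saves one, and \<open>t\<close>, where two of the
          remaining edges meet, saves another.\<close>
        then obtain e1 e2 t where e: "e1 \<in> R" "e2 \<in> R" "e1 \<noteq> e2" "t \<in> e1" "t \<in> e2"
          by (auto simp: pairwise_def disjnt_iff)
        obtain F where F: "F \<subseteq> insert t (\<Union>R)" "finite F"
          "card F + card {c\<in>R. t \<in> c} \<le> card R + 1" "\<And>c. c \<in> R \<Longrightarrow> c \<inter> F \<noteq> {}"
          by (rule cover_through_vertex[OF finR neR, of t]) auto
        have "card {e1, e2} \<le> card {c\<in>R. t \<in> c}"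
          using e finR by (intro card_mono) auto
        then have "card F + 2 \<le> card R + 1" using e F by simp
        then have "card (insert x F) + 2 \<le> card C"
          using F(2) cardR by (simp add: card_insert_if)
        moreover have "insert x F \<subseteq> \<Union>C" using F(1) e c by (auto simp: R_def)
        moreover have "c \<inter> insert x F \<noteq> {}" if "c \<in> C" for c
          using F(4)[of c] that c by (auto simp: R_def)
        ultimately show ?thesis by (intro cover)
      next
        case match: True
        show ?thesis
        proof (cases "{y, z} \<in> R")
          case True
          \<comment> \<open>Now \<open>x\<close>, \<open>y\<close>, \<open>z\<close> form a triangle
            that no other edge touches. Any two of its vertices cover it, so beside \<open>z\<close>
            either \<open>x\<close> or \<open>y\<close> may be taken.\<close>
          obtain F where F: "F \<subseteq> \<Union>(R - {{y, z}})" "finite F" "card F \<le> card (R - {{y, z}})"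
            "\<And>c. c \<in> R - {{y, z}} \<Longrightarrow> c \<inter> F \<noteq> {}"
            by (rule exists_small_cover[of "R - {{y, z}}"]) (use finR neR in auto)
          have "x \<notin> c \<and> y \<notin> c" if "c \<in> R - {{y, z}}" for c
            using pairwiseD[OF match, of c "{y, z}"] True that xR by (auto simp: disjnt_iff)
          then have F': "x \<notin> F" "y \<notin> F" using F(1) by auto
          have "card F + 1 \<le> card R"
            using F(3) card_Suc_Diff1[OF finR True] by simp
          then have "card (insert z F) + 2 \<le> card C"
            using F(2) cardR by (simp add: card_insert_if)
          moreover have "c \<inter> insert x (insert z F) \<noteq> {}" "c \<inter> insert y (insert z F) \<noteq> {}" 
            if "c \<in> C" for c
            using F(4)[of c] that yz by (auto simp: R_def)
          moreover have "insert z F \<subseteq> \<Union>C" using F(1) c yz by (auto simp: R_def)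
          ultimately show ?thesis
            using exchange[of "insert z F" x y] F' yz c by auto
        next
          case False
          \<comment> \<open>The colour class consists of \<open>y\<close>, \<open>z\<close> and one
            end of each edge of \<open>M\<close>. An edge of \<open>R\<close> outside
            \<open>M\<close> contains exactly one of \<open>y\<close>, \<open>z\<close>, as
            \<open>{y, z}\<close> is not in \<open>R\<close>, and is disjoint from the edges of
            \<open>M\<close>.\<close>
          define M where "M = {c\<in>R. y \<notin> c \<and> z \<notin> c}"
          have "pairwise disjnt M" using match by (auto simp: M_def pairwise_def)
          then obtain T where T: "T \<subseteq> \<Union>M" "\<And>c. c \<in> M \<Longrightarrow> \<exists>x. c \<inter> T = {x}"
            using matching_transversal[of M] neR by (auto simp: M_def)
          have xyz: "x \<notin> T" "y \<notin> T" "z \<notin> T" using T(1) xR by (auto simp: M_def)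
          have "\<exists>w. c \<inter> ({y, z} \<union> T) = {w}" if "c \<in> C" for c
          proof -
            consider "c = c1" | "c = c2" | "c \<in> M" | "c \<in> R" "c \<notin> M"
              using \<open>c \<in> C\<close> unfolding R_def by blast
            then show ?thesis
            proof cases
              case 4
              then have "c \<inter> T = {}"
                using T(1) pairwiseD[OF match \<open>c \<in> R\<close>] by (fastforce simp: M_def disjnt_iff)
              moreover have "c \<inter> {y, z} \<noteq> {}" "c \<noteq> {y, z}" using 4 False by (auto simp: M_def)
              moreover have "card c = 2" using that two by simp
              ultimately show ?thesis
                using yz(5) by (auto simp: card_2_iff)
            next
              case 3
              then have "c \<inter> ({y, z} \<union> T) = c \<inter> T" by (auto simp: M_def)
              then show ?thesis using T(2) 3 by simp
            qed (use yz xyz in auto)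
          qed
          then show ?thesis by (rule bipartite)
        qed
      qed
    qed
  qed
qed

subsection \<open>Biplanarity\<close>

lemma small_graph_planar:
  assumes "graph V E" "card E \<le> 8"
  shows "planar V E"
  using small_graph_straight_line_planar[OF assms(1)] assms geometric_complex_imp_planar by fastforce

lemma nine_edge_graph_planar_or_cubic:
  assumes "graph V E" "card E \<le> 9" "\<not> planar V E" "v \<in> \<Union>E"
  shows "card {e\<in>E. v \<in> e} = 3"
  using small_graph_straight_line_planar[OF assms(1,2)] assms(3,4)
    geometric_complex_imp_planar[OF assms(1)] by blast

text \<open>If both graphs were nonplanar, both would be cubic on their supports. An end of
  \<open>b\<close> then has degree 2 in \<open>S\<close>, and only \<open>a\<close> can raise this
  to 3 in the other graph. Hence \<open>b\<close> is contained in \<open>a\<close>, and the two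
  edges coincide.\<close>

lemma exchanged_edge_planar:
  assumes G: "graph V (insert a (insert b S))" and S: "card S \<le> 8" "a \<notin> S" "b \<notin> S" "a \<noteq> b"
  shows "planar V (insert a S) \<or> planar V (insert b S)"
proof (rule ccontr)
  assume "\<not> ?thesis"
  then have np: "\<not> planar V (insert a S)" "\<not> planar V (insert b S)" by auto
  have Ga: "graph V (insert a S)" and Gb: "graph V (insert b S)"
    by (rule graph_mono[OF G]; blast)+
  have fin: "finite S" using graph_finite_edges[OF Ga] by simp
  then have "card (insert a S) \<le> 9" "card (insert b S) \<le> 9" using S by simp_all
  then have deg: "v \<in> \<Union>(insert a S) \<Longrightarrow> card {e\<in>insert a S. v \<in> e} = 3"
    "v \<in> \<Union>(insert b S) \<Longrightarrow> card {e\<in>insert b S. v \<in> e} = 3" for v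
    using nine_edge_graph_planar_or_cubic[OF Ga _ np(1)]
      nine_edge_graph_planar_or_cubic[OF Gb _ np(2)] by blast+
  have deg_insert: "card {e\<in>insert x S. v \<in> e} = card {e\<in>S. v \<in> e} + (if v \<in> x then 1 else 0)"
    if "x \<notin> S" for x v
  proof -
    have "{e\<in>insert x S. v \<in> e} = (if v \<in> x then insert x {e\<in>S. v \<in> e} else {e\<in>S. v \<in> e})" by auto
    then show ?thesis using that fin by simp
  qed
  have "b \<subseteq> a"
  proof
    fix v assume v: "v \<in> b"
    then have "card {e\<in>S. v \<in> e} = 2" using deg(2)[of v] deg_insert[OF S(3)] by simp
    \<comment> \<open>Degree 2 in \<open>S\<close> puts \<open>v\<close> into the support of
      \<open>insert a S\<close>, where the degree condition for \<open>a\<close> applies.\<close>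
    then have "{e\<in>S. v \<in> e} \<noteq> {}" by fastforce
    then have "v \<in> \<Union>(insert a S)" by blast
    then show "v \<in> a" using deg(1)[of v] deg_insert[OF S(2)] \<open>card {e\<in>S. v \<in> e} = 2\<close>
      by (simp split: if_splits)
  qed
  moreover have "card a = 2" "card b = 2" using graph_card_edge[OF G] by auto
  ultimately show False using S(4) by (metis card_subset_eq card.infinite zero_neq_numeral)
qed

lemma drawing_mono:
  "drawing V E p \<gamma> \<Longrightarrow> F \<subseteq> E \<Longrightarrow> drawing V F p \<gamma>"
  unfolding drawing_def by (elim conjE, intro conjI) (assumption, rule ballI, drule bspec, erule subsetD)

theorem theorem4:
  fixes V :: "'a set" and E :: "'a set set"
  assumes "graph V E" and "cr V E \<le> 10"
  shows "biplanar V E"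
proof -
  note G = assms(1)
  have "\<exists>k p \<gamma>. simple_drawing V E p \<gamma> \<and> crossings E p \<gamma> = k"
    using exists_simple_drawing[OF G] by blast
  then have "\<exists>p \<gamma>. simple_drawing V E p \<gamma> \<and> crossings E p \<gamma> = cr V E"
    unfolding cr_def by (rule LeastI_ex)
  then obtain p \<gamma> where D: "simple_drawing V E p \<gamma>" and cr: "crossings E p \<gamma> \<le> 10"
    using assms(2) by auto
  have dr: "drawing V E p \<gamma>" using D by (simp add: simple_drawing_def)
  define C where "C = {{e, f} | e f. e \<in> E \<and> f \<in> E \<and> e \<noteq> f \<and>
      edge_interior p \<gamma> e \<inter> edge_interior p \<gamma> f \<noteq> {}}"
  have cardC: "card C \<le> 10" using cr by (simp add: crossings_def C_def)
  have CE: "\<Union>C \<subseteq> E" by (auto simp: C_def)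
  have "C \<subseteq> Pow E" by (auto simp: C_def)
  then have finC: "finite C" using graph_finite_edges[OF G] finite_subset by blast
  have two: "card c = 2" if c: "c \<in> C" for c
  proof -
    obtain e f where "c = {e, f}" "e \<noteq> f" using c unfolding C_def by blast
    then show ?thesis by simp
  qed
  have independent_planar: "planar V F" if F: "F \<subseteq> E" "\<And>c. c \<in> C \<Longrightarrow> \<not> c \<subseteq> F" for F
    unfolding planar_def
  proof (intro exI conjI ballI impI)
    show "drawing V F p \<gamma>" by (rule drawing_mono[OF dr F(1)])
    fix e f assume "e \<in> F" "f \<in> F" "e \<noteq> f"
    then have "{e, f} \<notin> C" "e \<in> E" "f \<in> E" using F by auto
    then show "edge_interior p \<gamma> e \<inter> edge_interior p \<gamma> f = {}"
      using \<open>e \<noteq> f\<close> unfolding C_def by blast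
  qed
  have cover_biplanar: "biplanar V E"
    if F: "F \<subseteq> E" "\<And>c. c \<in> C \<Longrightarrow> c \<inter> F \<noteq> {}" "planar V F" for F
  proof -
    have "planar V (E - F)"
      by (rule independent_planar) (use F(2) in blast)+
    moreover have "E = F \<union> (E - F)" "F \<inter> (E - F) = {}" using F(1) by auto
    ultimately show ?thesis using F(3) unfolding biplanar_def by blast
  qed
  \<comment> \<open>The bound 10 enters only here: saving two leaves at most eight edges in
    \<open>F\<close> or \<open>S\<close>, hence at most nine in an exchanged cover.\<close>
  show ?thesis
  proof (rule bipartite_or_cover[OF finC two])
    fix X assume X: "\<And>c. c \<in> C \<Longrightarrow> \<exists>x. c \<inter> X = {x}"
    show ?thesis
    proof (rule cover_biplanar)
      \<comment> \<open>The colour class \<open>X\<close> need not consist of edges of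
        \<open>G\<close>, so it is cut down to \<open>E\<close>. As every conflict lies in
        \<open>E\<close>, the result is still both a cover and independent.\<close>
      show "c \<inter> (E \<inter> X) \<noteq> {}" if "c \<in> C" for c
        using X[OF that] CE that by blast
      show "planar V (E \<inter> X)"
      proof (rule independent_planar)
        fix c assume c: "c \<in> C"
        show "\<not> c \<subseteq> E \<inter> X"
        proof
          assume "c \<subseteq> E \<inter> X"
          then have "c \<inter> X = c" by blast
          then obtain x where "c = {x}" using X[OF c] by metis
          then show False using two[OF c] by simp
        qed
      qed simp
    qed simp
  next
    fix F assume F: "F \<subseteq> \<Union>C" "card F + 2 \<le> card C" "\<And>c. c \<in> C \<Longrightarrow> c \<inter> F \<noteq> {}"
    have "F \<subseteq> E" using F(1) CE by (rule order_trans)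
    then show ?thesis
    proof (rule cover_biplanar[OF _ F(3)])
      show "planar V F"
        by (rule small_graph_planar[OF graph_mono[OF G \<open>F \<subseteq> E\<close>]]) (use F(2) cardC in simp)
    qed
  next
    fix S a b assume S: "S \<subseteq> \<Union>C" and ab: "a \<in> \<Union>C" "b \<in> \<Union>C" "a \<notin> S" "b \<notin> S" "a \<noteq> b"
      and card: "card S + 2 \<le> card C"
      and a: "\<And>c. c \<in> C \<Longrightarrow> c \<inter> insert a S \<noteq> {}" and b: "\<And>c. c \<in> C \<Longrightarrow> c \<inter> insert b S \<noteq> {}"
    have sub: "insert a (insert b S) \<subseteq> E" using S ab(1,2) CE by blast
    then have "planar V (insert a S) \<or> planar V (insert b S)"
      using card cardC by (intro exchanged_edge_planar[OF graph_mono[OF G sub] _ ab(3-5)]) simp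
    then show ?thesis
    proof
      assume "planar V (insert a S)"
      then show ?thesis by (rule cover_biplanar[OF _ a, rotated 2]) (use sub in auto)
    next
      assume "planar V (insert b S)"
      then show ?thesis by (rule cover_biplanar[OF _ b, rotated 2]) (use sub in auto)
    qed
  qed
qed

end
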